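(* Let $R$ be a commutative ring with a unit, and let $A,B$ be two non-trivial $R$-modules. If there are an $R$-module $C$ and a pairing $\langle\cdot\mid\cdot\rangle\colon A\times B\rightarrow C$, then the canonical bilinear map $\otimes\colon A\times B\rightarrow A\otimes_R B$, $(a,b)\mapsto a\otimes b$, is non-degenerate.
   Context: An $R$-bilinear map $f\colon A\times B\to C$ between $R$-modules is left non-degenerate if $f(a,b)=0_C$ for every $b\in B$ implies $a=0_A$; right non-degenerate if $f(a,b)=0_C$ for every $a\in A$ implies $b=0_B$; and non-degenerate if it is both left and right non-degenerate. A pairing is a non-degenerate $R$-bilinear map. *)

theory Defs
  imports "HOL-Algebra.Module" "HOL-Algebra.AbelCoset"
begin

section \<open>Bilinear maps and pairings\<close>

locale bilinear_map =
  A: module R A + B: module R B + C: module R C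
  for R :: "('r, 'm) ring_scheme" (structure)
    and A :: "('r, 'a, 'n) module_scheme"
    and B :: "('r, 'b, 'p) module_scheme"
    and C :: "('r, 'c, 'q) module_scheme"
    and f :: "'a \<Rightarrow> 'b \<Rightarrow> 'c" +
  assumes map_closed:
      "\<lbrakk>a \<in> carrier A; b \<in> carrier B\<rbrakk> \<Longrightarrow> f a b \<in> carrier C"
    and add_left:
      "\<lbrakk>a \<in> carrier A; a' \<in> carrier A; b \<in> carrier B\<rbrakk>
        \<Longrightarrow> f (a \<oplus>\<^bsub>A\<^esub> a') b = f a b \<oplus>\<^bsub>C\<^esub> f a' b"
    and add_right:
      "\<lbrakk>a \<in> carrier A; b \<in> carrier B; b' \<in> carrier B\<rbrakk>
        \<Longrightarrow> f a (b \<oplus>\<^bsub>B\<^esub> b') = f a b \<oplus>\<^bsub>C\<^esub> f a b'"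
    and smult_left:
      "\<lbrakk>r \<in> carrier R; a \<in> carrier A; b \<in> carrier B\<rbrakk>
        \<Longrightarrow> f (r \<odot>\<^bsub>A\<^esub> a) b = r \<odot>\<^bsub>C\<^esub> f a b"
    and smult_right:
      "\<lbrakk>r \<in> carrier R; a \<in> carrier A; b \<in> carrier B\<rbrakk>
        \<Longrightarrow> f a (r \<odot>\<^bsub>B\<^esub> b) = r \<odot>\<^bsub>C\<^esub> f a b"

definition left_nondegenerate ::
  "('r, 'a, 'n) module_scheme \<Rightarrow> ('r, 'b, 'p) module_scheme \<Rightarrow> ('r, 'c, 'q) module_scheme
    \<Rightarrow> ('a \<Rightarrow> 'b \<Rightarrow> 'c) \<Rightarrow> bool" where
  "left_nondegenerate A B C f \<longleftrightarrow>
    (\<forall>a \<in> carrier A. (\<forall>b \<in> carrier B. f a b = \<zero>\<^bsub>C\<^esub>) \<longrightarrow> a = \<zero>\<^bsub>A\<^esub>)"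

definition right_nondegenerate ::
  "('r, 'a, 'n) module_scheme \<Rightarrow> ('r, 'b, 'p) module_scheme \<Rightarrow> ('r, 'c, 'q) module_scheme
    \<Rightarrow> ('a \<Rightarrow> 'b \<Rightarrow> 'c) \<Rightarrow> bool" where
  "right_nondegenerate A B C f \<longleftrightarrow>
    (\<forall>b \<in> carrier B. (\<forall>a \<in> carrier A. f a b = \<zero>\<^bsub>C\<^esub>) \<longrightarrow> b = \<zero>\<^bsub>B\<^esub>)"

definition nondegenerate ::
  "('r, 'a, 'n) module_scheme \<Rightarrow> ('r, 'b, 'p) module_scheme \<Rightarrow> ('r, 'c, 'q) module_scheme
    \<Rightarrow> ('a \<Rightarrow> 'b \<Rightarrow> 'c) \<Rightarrow> bool" where
  "nondegenerate A B C f \<longleftrightarrow> left_nondegenerate A B C f \<and> right_nondegenerate A B C f"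

locale pairing = bilinear_map +
  assumes nondegenerate: "nondegenerate A B C f"


section \<open>The tensor product of modules\<close>

text \<open>
  The type of module records extends that of rings, so a module record also has multiplicative
  fields. They play no role in the locale \<^locale>\<open>module\<close> and are left undefined below.
\<close>

definition free_module ::
  "('r, 'm) ring_scheme \<Rightarrow> 's set \<Rightarrow> ('r, 's \<Rightarrow> 'r) module" where
  "free_module R S =
    \<lparr>carrier = {g. (\<forall>x \<in> S. g x \<in> carrier R) \<and> (\<forall>x. x \<notin> S \<longrightarrow> g x = \<zero>\<^bsub>R\<^esub>)
        \<and> finite {x. g x \<noteq> \<zero>\<^bsub>R\<^esub>}},
     mult = undefined, one = undefined,
     zero = (\<lambda>x. \<zero>\<^bsub>R\<^esub>), add = (\<lambda>g h x. g x \<oplus>\<^bsub>R\<^esub> h x),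
     smult = (\<lambda>r g x. r \<otimes>\<^bsub>R\<^esub> g x)\<rparr>"

definition free_basis :: "('r, 'm) ring_scheme \<Rightarrow> 's \<Rightarrow> 's \<Rightarrow> 'r" where
  "free_basis R x = (\<lambda>y. if y = x then \<one>\<^bsub>R\<^esub> else \<zero>\<^bsub>R\<^esub>)"

definition generated_submodule ::
  "('r, 'm) ring_scheme \<Rightarrow> ('r, 'a, 'n) module_scheme \<Rightarrow> 'a set \<Rightarrow> 'a set" where
  "generated_submodule R M X = \<Inter>{H. submodule H R M \<and> X \<subseteq> H}"

text \<open>
  For a submodule \<open>N\<close>, the union below is the single coset of \<open>r \<odot> x\<close>, for any
  representative \<open>x\<close> of the coset \<open>X\<close>.
\<close>

definition quotient_module ::
  "('r, 'm) ring_scheme \<Rightarrow> ('r, 'a, 'n) module_scheme \<Rightarrow> 'a set \<Rightarrow> ('r, 'a set) module" where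
  "quotient_module R M N =
    \<lparr>carrier = a_rcosets\<^bsub>M\<^esub> N,
     mult = undefined, one = undefined,
     zero = N, add = set_add M,
     smult = (\<lambda>r X. \<Union>x \<in> X. N +>\<^bsub>M\<^esub> (r \<odot>\<^bsub>M\<^esub> x))\<rparr>"

inductive_set tensor_relators ::
  "('r, 'm) ring_scheme \<Rightarrow> ('r, 'a, 'n) module_scheme \<Rightarrow> ('r, 'b, 'p) module_scheme
    \<Rightarrow> ('a \<times> 'b \<Rightarrow> 'r) set"
  for R :: "('r, 'm) ring_scheme"
    and A :: "('r, 'a, 'n) module_scheme"
    and B :: "('r, 'b, 'p) module_scheme" where
  add_left: "\<lbrakk>a \<in> carrier A; a' \<in> carrier A; b \<in> carrier B;
      F = free_module R (carrier A \<times> carrier B)\<rbrakk> \<Longrightarrow>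
      free_basis R (a \<oplus>\<^bsub>A\<^esub> a', b) \<ominus>\<^bsub>F\<^esub> (free_basis R (a, b) \<oplus>\<^bsub>F\<^esub> free_basis R (a', b))
        \<in> tensor_relators R A B"
| add_right: "\<lbrakk>a \<in> carrier A; b \<in> carrier B; b' \<in> carrier B;
      F = free_module R (carrier A \<times> carrier B)\<rbrakk> \<Longrightarrow>
      free_basis R (a, b \<oplus>\<^bsub>B\<^esub> b') \<ominus>\<^bsub>F\<^esub> (free_basis R (a, b) \<oplus>\<^bsub>F\<^esub> free_basis R (a, b'))
        \<in> tensor_relators R A B"
| smult_left: "\<lbrakk>r \<in> carrier R; a \<in> carrier A; b \<in> carrier B;
      F = free_module R (carrier A \<times> carrier B)\<rbrakk> \<Longrightarrow>
      free_basis R (r \<odot>\<^bsub>A\<^esub> a, b) \<ominus>\<^bsub>F\<^esub> r \<odot>\<^bsub>F\<^esub> free_basis R (a, b)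
        \<in> tensor_relators R A B"
| smult_right: "\<lbrakk>r \<in> carrier R; a \<in> carrier A; b \<in> carrier B;
      F = free_module R (carrier A \<times> carrier B)\<rbrakk> \<Longrightarrow>
      free_basis R (a, r \<odot>\<^bsub>B\<^esub> b) \<ominus>\<^bsub>F\<^esub> r \<odot>\<^bsub>F\<^esub> free_basis R (a, b)
        \<in> tensor_relators R A B"

definition tensor_kernel ::
  "('r, 'm) ring_scheme \<Rightarrow> ('r, 'a, 'n) module_scheme \<Rightarrow> ('r, 'b, 'p) module_scheme
    \<Rightarrow> ('a \<times> 'b \<Rightarrow> 'r) set" where
  "tensor_kernel R A B =
    generated_submodule R (free_module R (carrier A \<times> carrier B)) (tensor_relators R A B)"

definition tensor_product ::
  "('r, 'm) ring_scheme \<Rightarrow> ('r, 'a, 'n) module_scheme \<Rightarrow> ('r, 'b, 'p) module_scheme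
    \<Rightarrow> ('r, ('a \<times> 'b \<Rightarrow> 'r) set) module" where
  "tensor_product R A B =
    quotient_module R (free_module R (carrier A \<times> carrier B)) (tensor_kernel R A B)"

definition tensor ::
  "('r, 'm) ring_scheme \<Rightarrow> ('r, 'a, 'n) module_scheme \<Rightarrow> ('r, 'b, 'p) module_scheme
    \<Rightarrow> 'a \<Rightarrow> 'b \<Rightarrow> ('a \<times> 'b \<Rightarrow> 'r) set" where
  "tensor R A B a b =
    tensor_kernel R A B +>\<^bsub>free_module R (carrier A \<times> carrier B)\<^esub> free_basis R (a, b)"


section \<open>The tensor product is a module and its canonical map is bilinear\<close>

lemma free_module_simps [simp]:
  "\<zero>\<^bsub>free_module R S\<^esub> = (\<lambda>x. \<zero>\<^bsub>R\<^esub>)"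
  "g \<oplus>\<^bsub>free_module R S\<^esub> h = (\<lambda>x. g x \<oplus>\<^bsub>R\<^esub> h x)"
  "r \<odot>\<^bsub>free_module R S\<^esub> g = (\<lambda>x. r \<otimes>\<^bsub>R\<^esub> g x)"
  by (simp_all add: free_module_def)

lemma free_module_carrier:
  "g \<in> carrier (free_module R S) \<longleftrightarrow>
    (\<forall>x \<in> S. g x \<in> carrier R) \<and> (\<forall>x. x \<notin> S \<longrightarrow> g x = \<zero>\<^bsub>R\<^esub>) \<and> finite {x. g x \<noteq> \<zero>\<^bsub>R\<^esub>}"
  by (simp add: free_module_def)

context cring
begin

lemma free_module_closed:
  "g \<in> carrier (free_module R S) \<Longrightarrow> g x \<in> carrier R"
  by (cases "x \<in> S") (auto simp: free_module_carrier)

lemma free_module_is_module: "module R (free_module R S)"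
proof (rule moduleI[OF is_cring])
  let ?F = "free_module R S"
  show "abelian_group ?F"
  proof (rule abelian_groupI)
    fix g h assume g: "g \<in> carrier ?F" and h: "h \<in> carrier ?F"
    have "{x. g x \<oplus> h x \<noteq> \<zero>} \<subseteq> {x. g x \<noteq> \<zero>} \<union> {x. h x \<noteq> \<zero>}" by auto
    then show "g \<oplus>\<^bsub>?F\<^esub> h \<in> carrier ?F"
      using g h by (auto simp: free_module_carrier intro: finite_subset)
  next
    fix g h k assume "g \<in> carrier ?F" "h \<in> carrier ?F" "k \<in> carrier ?F"
    then show "g \<oplus>\<^bsub>?F\<^esub> h \<oplus>\<^bsub>?F\<^esub> k = g \<oplus>\<^bsub>?F\<^esub> (h \<oplus>\<^bsub>?F\<^esub> k)"
      by (auto simp: fun_eq_iff a_assoc free_module_closed)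
  next
    fix g h assume "g \<in> carrier ?F" "h \<in> carrier ?F"
    then show "g \<oplus>\<^bsub>?F\<^esub> h = h \<oplus>\<^bsub>?F\<^esub> g"
      by (auto simp: fun_eq_iff a_comm free_module_closed)
  next
    fix g assume g: "g \<in> carrier ?F"
    then show "\<zero>\<^bsub>?F\<^esub> \<oplus>\<^bsub>?F\<^esub> g = g"
      by (auto simp: fun_eq_iff free_module_closed)
    have "{x. \<ominus> g x \<noteq> \<zero>} \<subseteq> {x. g x \<noteq> \<zero>}" by auto
    then have "(\<lambda>x. \<ominus> g x) \<in> carrier ?F"
      using g by (auto simp: free_module_carrier intro: finite_subset)
    moreover have "(\<lambda>x. \<ominus> g x) \<oplus>\<^bsub>?F\<^esub> g = \<zero>\<^bsub>?F\<^esub>"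
      using g by (auto simp: fun_eq_iff l_neg free_module_closed)
    ultimately show "\<exists>h \<in> carrier ?F. h \<oplus>\<^bsub>?F\<^esub> g = \<zero>\<^bsub>?F\<^esub>" by blast
  qed (auto simp: free_module_carrier)
next
  let ?F = "free_module R S"
  fix r g assume r: "r \<in> carrier R" and g: "g \<in> carrier ?F"
  have "{x. r \<otimes> g x \<noteq> \<zero>} \<subseteq> {x. g x \<noteq> \<zero>}" using r by auto
  then show "r \<odot>\<^bsub>?F\<^esub> g \<in> carrier ?F"
    using r g by (auto simp: free_module_carrier intro: finite_subset)
qed (auto simp: fun_eq_iff free_module_closed l_distr r_distr m_assoc)

lemma free_basis_closed: "x \<in> S \<Longrightarrow> free_basis R x \<in> carrier (free_module R S)"
  by (auto simp: free_module_carrier free_basis_def intro: finite_subset[of _ "{x}"])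

end

context module
begin

lemma generated_submodule_is_submodule:
  assumes "X \<subseteq> carrier M"
  shows "submodule (generated_submodule R M X) R M"
proof (rule submoduleI)
  show "generated_submodule R M X \<subseteq> carrier M"
    using assms carrier_is_submodule by (auto simp: generated_submodule_def)
next
  show "\<zero>\<^bsub>M\<^esub> \<in> generated_submodule R M X"
    unfolding generated_submodule_def
    using subgroup.one_closed[OF submodule.axioms(1)] by fastforce
qed (auto simp: generated_submodule_def dest: submoduleE)

lemma generated_submodule_incl: "X \<subseteq> generated_submodule R M X"
  by (auto simp: generated_submodule_def)

lemma submodule_abelian_subgroup: "submodule N R M \<Longrightarrow> abelian_subgroup N M"
  using M.abelian_group_axioms abelian_subgroupI3 additive_subgroup.intro submodule.axioms(1)
  by blast

context
  fixes N assumes N: "submodule N R M"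
begin

interpretation N: abelian_subgroup N M
  using N by (rule submodule_abelian_subgroup)

lemma mem_coset_iff:
  assumes "x \<in> carrier M" "y \<in> carrier M"
  shows "x \<in> N +>\<^bsub>M\<^esub> y \<longleftrightarrow> x \<ominus>\<^bsub>M\<^esub> y \<in> N"
  using N.a_rcos_module[OF assms(2,1)] unfolding a_minus_def .

lemma coset_eq_iff:
  assumes "x \<in> carrier M" "y \<in> carrier M"
  shows "N +>\<^bsub>M\<^esub> x = N +>\<^bsub>M\<^esub> y \<longleftrightarrow> x \<ominus>\<^bsub>M\<^esub> y \<in> N"
proof
  assume "N +>\<^bsub>M\<^esub> x = N +>\<^bsub>M\<^esub> y"
  then have "x \<in> N +>\<^bsub>M\<^esub> y" using N.a_rcos_self[OF assms(1)] by simp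
  then show "x \<ominus>\<^bsub>M\<^esub> y \<in> N" using assms by (simp add: mem_coset_iff)
next
  assume "x \<ominus>\<^bsub>M\<^esub> y \<in> N"
  then have "x \<in> N +>\<^bsub>M\<^esub> y" using assms by (simp add: mem_coset_iff)
  then show "N +>\<^bsub>M\<^esub> x = N +>\<^bsub>M\<^esub> y"
    using N.a_repr_independence'[OF _ assms(2)] by simp
qed

lemma quotient_module_add:
  assumes "x \<in> carrier M" "y \<in> carrier M"
  shows "(N +>\<^bsub>M\<^esub> x) \<oplus>\<^bsub>quotient_module R M N\<^esub> (N +>\<^bsub>M\<^esub> y) = N +>\<^bsub>M\<^esub> (x \<oplus>\<^bsub>M\<^esub> y)"
  using assms by (simp add: quotient_module_def N.a_rcos_sum)

lemma quotient_module_smult: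
  assumes r: "r \<in> carrier R" and x: "x \<in> carrier M"
  shows "r \<odot>\<^bsub>quotient_module R M N\<^esub> (N +>\<^bsub>M\<^esub> x) = N +>\<^bsub>M\<^esub> (r \<odot>\<^bsub>M\<^esub> x)"
proof -
  have "N +>\<^bsub>M\<^esub> (r \<odot>\<^bsub>M\<^esub> y) = N +>\<^bsub>M\<^esub> (r \<odot>\<^bsub>M\<^esub> x)" if y: "y \<in> N +>\<^bsub>M\<^esub> x" for y
  proof -
    have yc: "y \<in> carrier M" using y x N.a_elemrcos_carrier by blast
    have "y \<ominus>\<^bsub>M\<^esub> x \<in> N"
      using y yc x by (simp add: mem_coset_iff)
    then have "r \<odot>\<^bsub>M\<^esub> (y \<ominus>\<^bsub>M\<^esub> x) \<in> N" using r submoduleE(4)[OF N] by blast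
    moreover have "r \<odot>\<^bsub>M\<^esub> (y \<ominus>\<^bsub>M\<^esub> x) = r \<odot>\<^bsub>M\<^esub> y \<ominus>\<^bsub>M\<^esub> r \<odot>\<^bsub>M\<^esub> x"
      using r x yc by (simp add: a_minus_def smult_r_distr smult_r_minus)
    ultimately show ?thesis using r x yc by (simp add: coset_eq_iff)
  qed
  moreover have "x \<in> N +>\<^bsub>M\<^esub> x" using x by (rule N.a_rcos_self)
  ultimately have "(\<Union>y \<in> N +>\<^bsub>M\<^esub> x. N +>\<^bsub>M\<^esub> (r \<odot>\<^bsub>M\<^esub> y)) = N +>\<^bsub>M\<^esub> (r \<odot>\<^bsub>M\<^esub> x)"
    by blast
  then show ?thesis by (simp add: quotient_module_def)
qed

lemma quotient_module_carrier:
  "X \<in> carrier (quotient_module R M N) \<longleftrightarrow> (\<exists>x \<in> carrier M. X = N +>\<^bsub>M\<^esub> x)"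
  by (auto simp: quotient_module_def A_RCOSETS_def')

lemma quotient_module_zero: "\<zero>\<^bsub>quotient_module R M N\<^esub> = N +>\<^bsub>M\<^esub> \<zero>\<^bsub>M\<^esub>"
  using N.a_subset by (simp add: quotient_module_def M.a_coset_add_zero)

lemma quotient_module_is_module: "module R (quotient_module R M N)"
proof (rule moduleI[OF R.is_cring])
  let ?Q = "quotient_module R M N"
  show "abelian_group ?Q"
  proof (rule abelian_groupI)
    fix X assume "X \<in> carrier ?Q"
    then obtain x where x: "x \<in> carrier M" "X = N +>\<^bsub>M\<^esub> x"
      by (auto simp: quotient_module_carrier)
    then show "\<exists>Y \<in> carrier ?Q. Y \<oplus>\<^bsub>?Q\<^esub> X = \<zero>\<^bsub>?Q\<^esub>"
      by (intro bexI[of _ "N +>\<^bsub>M\<^esub> (\<ominus>\<^bsub>M\<^esub> x)"])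
        (auto simp: quotient_module_carrier quotient_module_add quotient_module_zero M.l_neg)
  next
    fix X Y assume "X \<in> carrier ?Q" "Y \<in> carrier ?Q"
    then obtain x y where "x \<in> carrier M" "X = N +>\<^bsub>M\<^esub> x" "y \<in> carrier M" "Y = N +>\<^bsub>M\<^esub> y"
      by (auto simp: quotient_module_carrier)
    then show "X \<oplus>\<^bsub>?Q\<^esub> Y = Y \<oplus>\<^bsub>?Q\<^esub> X"
      using M.a_comm[of x y] by (simp add: quotient_module_add)
  qed (auto simp: quotient_module_carrier quotient_module_add quotient_module_zero M.a_assoc)
qed (auto simp: quotient_module_carrier quotient_module_add quotient_module_smult
    smult_l_distr smult_r_distr smult_assoc1)

end

end

context
  fixes R :: "('r, 'm) ring_scheme"
    and A :: "('r, 'a, 'n) module_scheme"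
    and B :: "('r, 'b, 'p) module_scheme"
  assumes A: "module R A" and B: "module R B"
begin

interpretation A: module R A by (rule A)
interpretation B: module R B by (rule B)
interpretation F: module R "free_module R (carrier A \<times> carrier B)"
  by (rule A.R.free_module_is_module)

lemma tensor_relators_subset:
  "tensor_relators R A B \<subseteq> carrier (free_module R (carrier A \<times> carrier B))"
proof
  have basis: "free_basis R (a, b) \<in> carrier (free_module R (carrier A \<times> carrier B))"
    if "a \<in> carrier A" "b \<in> carrier B" for a b
    using that by (simp add: A.R.free_basis_closed)
  fix x assume "x \<in> tensor_relators R A B"
  then show "x \<in> carrier (free_module R (carrier A \<times> carrier B))"
    by cases
      (auto simp del: free_module_simps intro!: F.M.minus_closed F.M.a_closed F.smult_closed basis)
qed

lemma tensor_kernel_submodule: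
  "submodule (tensor_kernel R A B) R (free_module R (carrier A \<times> carrier B))"
  unfolding tensor_kernel_def
  by (rule F.generated_submodule_is_submodule[OF tensor_relators_subset])

lemma tensor_product_is_module: "module R (tensor_product R A B)"
  unfolding tensor_product_def
  by (rule F.quotient_module_is_module[OF tensor_kernel_submodule])

lemma tensor_bilinear_map: "bilinear_map R A B (tensor_product R A B) (tensor R A B)"
proof -
  let ?F = "free_module R (carrier A \<times> carrier B)"
  let ?N = "tensor_kernel R A B"
  note N = tensor_kernel_submodule
  have rel: "x \<in> ?N" if "x \<in> tensor_relators R A B" for x
    using that F.generated_submodule_incl by (auto simp: tensor_kernel_def)
  have basis: "free_basis R (a, b) \<in> carrier ?F" if "a \<in> carrier A" "b \<in> carrier B" for a b
    using that by (simp add: A.R.free_basis_closed)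
  note closed = basis F.M.a_closed F.smult_closed
  show ?thesis
  proof (intro bilinear_map.intro A B tensor_product_is_module bilinear_map_axioms.intro,
      unfold tensor_product_def tensor_def)
    fix a b assume "a \<in> carrier A" "b \<in> carrier B"
    then show "?N +>\<^bsub>?F\<^esub> free_basis R (a, b) \<in> carrier (quotient_module R ?F ?N)"
      using basis by (auto simp: F.quotient_module_carrier[OF N])
  next
    fix a a' b assume h: "a \<in> carrier A" "a' \<in> carrier A" "b \<in> carrier B"
    show "?N +>\<^bsub>?F\<^esub> free_basis R (a \<oplus>\<^bsub>A\<^esub> a', b) =
      (?N +>\<^bsub>?F\<^esub> free_basis R (a, b)) \<oplus>\<^bsub>quotient_module R ?F ?N\<^esub> (?N +>\<^bsub>?F\<^esub> free_basis R (a', b))"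
      unfolding F.quotient_module_add[OF N basis[OF h(1,3)] basis[OF h(2,3)]]
      using h by (subst F.coset_eq_iff[OF N])
        (auto simp del: free_module_simps intro!: closed rel tensor_relators.add_left)
  next
    fix a b b' assume h: "a \<in> carrier A" "b \<in> carrier B" "b' \<in> carrier B"
    show "?N +>\<^bsub>?F\<^esub> free_basis R (a, b \<oplus>\<^bsub>B\<^esub> b') =
      (?N +>\<^bsub>?F\<^esub> free_basis R (a, b)) \<oplus>\<^bsub>quotient_module R ?F ?N\<^esub> (?N +>\<^bsub>?F\<^esub> free_basis R (a, b'))"
      unfolding F.quotient_module_add[OF N basis[OF h(1,2)] basis[OF h(1,3)]]
      using h by (subst F.coset_eq_iff[OF N])
        (auto simp del: free_module_simps intro!: closed rel tensor_relators.add_right)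
  next
    fix r a b assume h: "r \<in> carrier R" "a \<in> carrier A" "b \<in> carrier B"
    show "?N +>\<^bsub>?F\<^esub> free_basis R (r \<odot>\<^bsub>A\<^esub> a, b) =
      r \<odot>\<^bsub>quotient_module R ?F ?N\<^esub> (?N +>\<^bsub>?F\<^esub> free_basis R (a, b))"
      unfolding F.quotient_module_smult[OF N h(1) basis[OF h(2,3)]]
      using h by (subst F.coset_eq_iff[OF N])
        (auto simp del: free_module_simps intro!: closed rel tensor_relators.smult_left)
    show "?N +>\<^bsub>?F\<^esub> free_basis R (a, r \<odot>\<^bsub>B\<^esub> b) =
      r \<odot>\<^bsub>quotient_module R ?F ?N\<^esub> (?N +>\<^bsub>?F\<^esub> free_basis R (a, b))"
      unfolding F.quotient_module_smult[OF N h(1) basis[OF h(2,3)]]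
      using h by (subst F.coset_eq_iff[OF N])
        (auto simp del: free_module_simps intro!: closed rel tensor_relators.smult_right)
  qed
qed

end

end

(* A bilinear map f on A x B extends linearly to the free module on A x B, and the extension kills
   the tensor relators, hence the whole tensor kernel. So if the tensor of a and b vanishes, then
   f a b = 0, and non-degeneracy of f passes to the canonical bilinear map. *)
theory Submission
  imports Defs
begin

text \<open>Summing over the support rather than over a whole index set keeps the sum finite on the
  free module. Over an infinite set the library sum would take its default value zero.\<close>

definition linear_extension ::
  "('r, 'm) ring_scheme \<Rightarrow> ('r, 'c, 'q) module_scheme \<Rightarrow> ('s \<Rightarrow> 'c) \<Rightarrow> ('s \<Rightarrow> 'r) \<Rightarrow> 'c" where
  "linear_extension R M \<phi> g = (\<Oplus>\<^bsub>M\<^esub>x \<in> {x. g x \<noteq> \<zero>\<^bsub>R\<^esub>}. g x \<odot>\<^bsub>M\<^esub> \<phi> x)"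

context module
begin

lemma generated_submodule_least:
  "submodule H R M \<Longrightarrow> X \<subseteq> H \<Longrightarrow> generated_submodule R M X \<subseteq> H"
  by (auto simp: generated_submodule_def)

context
  fixes S :: "'s set" and \<phi> :: "'s \<Rightarrow> 'c"
  assumes \<phi>: "\<phi> \<in> S \<rightarrow> carrier M"
begin

interpretation F: module R "free_module R S"
  by (rule R.free_module_is_module)

text \<open>The added terms have coefficient zero. This allows functions with different supports to
  be summed over one common finite set.\<close>

lemma linear_extension_superset:
  assumes g: "g \<in> carrier (free_module R S)"
    and T: "finite T" "{x. g x \<noteq> \<zero>} \<subseteq> T" "T \<subseteq> S"
  shows "linear_extension R M \<phi> g = (\<Oplus>\<^bsub>M\<^esub>x \<in> T. g x \<odot>\<^bsub>M\<^esub> \<phi> x)"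
  unfolding linear_extension_def
  using T \<phi> R.free_module_closed[OF g]
  by (intro M.add.finprod_mono_neutral_cong_left) (auto simp: Pi_iff subset_iff smult_l_null)

lemma support_subset: "g \<in> carrier (free_module R S) \<Longrightarrow> {x. g x \<noteq> \<zero>} \<subseteq> S"
  by (auto simp: free_module_carrier)

lemma linear_extension_closed:
  assumes g: "g \<in> carrier (free_module R S)"
  shows "linear_extension R M \<phi> g \<in> carrier M"
  unfolding linear_extension_def
  using support_subset[OF g] \<phi> R.free_module_closed[OF g]
  by (intro M.finsum_closed) (auto simp: Pi_iff)

lemma linear_extension_add:
  assumes g: "g \<in> carrier (free_module R S)" and h: "h \<in> carrier (free_module R S)"
  shows "linear_extension R M \<phi> (g \<oplus>\<^bsub>free_module R S\<^esub> h) =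
    linear_extension R M \<phi> g \<oplus>\<^bsub>M\<^esub> linear_extension R M \<phi> h"
proof -
  \<comment> \<open>Cancellation can make the support of the sum smaller than this union, but
    \<open>T\<close> contains all three supports.\<close>
  define T where "T = {x. g x \<noteq> \<zero>} \<union> {x. h x \<noteq> \<zero>}"
  have T: "finite T" "T \<subseteq> S"
    using g h by (auto simp: T_def free_module_carrier)
  have cl: "g x \<in> carrier R" "h x \<in> carrier R" for x
    using g h by (auto intro: R.free_module_closed)
  have \<phi>T: "\<phi> x \<in> carrier M" if "x \<in> T" for x
    using that T \<phi> by auto
  have "linear_extension R M \<phi> (g \<oplus>\<^bsub>free_module R S\<^esub> h) = (\<Oplus>\<^bsub>M\<^esub>x \<in> T. (g x \<oplus> h x) \<odot>\<^bsub>M\<^esub> \<phi> x)"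
    by (subst linear_extension_superset[OF F.M.a_closed[OF g h] T(1) _ T(2)]) (auto simp: T_def)
  also have "\<dots> = (\<Oplus>\<^bsub>M\<^esub>x \<in> T. g x \<odot>\<^bsub>M\<^esub> \<phi> x \<oplus>\<^bsub>M\<^esub> h x \<odot>\<^bsub>M\<^esub> \<phi> x)"
    using cl \<phi>T by (intro M.finsum_cong') (auto simp: smult_l_distr)
  also have "\<dots> = (\<Oplus>\<^bsub>M\<^esub>x \<in> T. g x \<odot>\<^bsub>M\<^esub> \<phi> x) \<oplus>\<^bsub>M\<^esub> (\<Oplus>\<^bsub>M\<^esub>x \<in> T. h x \<odot>\<^bsub>M\<^esub> \<phi> x)"
    using cl \<phi>T by (intro M.finsum_addf) auto
  also have "\<dots> = linear_extension R M \<phi> g \<oplus>\<^bsub>M\<^esub> linear_extension R M \<phi> h"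
    using linear_extension_superset[OF g T(1) _ T(2)] linear_extension_superset[OF h T(1) _ T(2)]
    by (simp add: T_def)
  finally show ?thesis .
qed

lemma linear_extension_smult:
  assumes r: "r \<in> carrier R" and g: "g \<in> carrier (free_module R S)"
  shows "linear_extension R M \<phi> (r \<odot>\<^bsub>free_module R S\<^esub> g) = r \<odot>\<^bsub>M\<^esub> linear_extension R M \<phi> g"
proof -
  let ?T = "{x. g x \<noteq> \<zero>}"
  have T: "finite ?T" "?T \<subseteq> S"
    using g by (auto simp: free_module_carrier)
  have cl: "g x \<in> carrier R" for x
    using g by (rule R.free_module_closed)
  have \<phi>T: "\<phi> x \<in> carrier M" if "x \<in> ?T" for x
    using that T \<phi> by blast
  \<comment> \<open>Scaling can shrink the support, as \<open>r\<close> may be zero or a zero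
    divisor, so the sum is taken over the support of \<open>g\<close>.\<close>
  have "linear_extension R M \<phi> (r \<odot>\<^bsub>free_module R S\<^esub> g) = (\<Oplus>\<^bsub>M\<^esub>x \<in> ?T. (r \<otimes> g x) \<odot>\<^bsub>M\<^esub> \<phi> x)"
    using r by (subst linear_extension_superset[OF F.smult_closed[OF r g] T(1) _ T(2)]) auto
  also have "\<dots> = (\<Oplus>\<^bsub>M\<^esub>x \<in> ?T. r \<odot>\<^bsub>M\<^esub> (g x \<odot>\<^bsub>M\<^esub> \<phi> x))"
    using r cl \<phi>T by (intro M.finsum_cong') (auto simp: smult_assoc1)
  also have "\<dots> = r \<odot>\<^bsub>M\<^esub> linear_extension R M \<phi> g"
    unfolding linear_extension_def
    using r cl \<phi>T T by (intro finsum_smult_ldistr[symmetric]) auto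
  finally show ?thesis .
qed

lemma linear_extension_basis:
  assumes x: "x \<in> S"
  shows "linear_extension R M \<phi> (free_basis R x) = \<phi> x"
proof -
  \<comment> \<open>The support is \<open>{x}\<close>, or empty if \<open>R\<close> is the zero
    ring. Summing over the superset \<open>{x}\<close> covers both cases.\<close>
  have "linear_extension R M \<phi> (free_basis R x) = (\<Oplus>\<^bsub>M\<^esub>y \<in> {x}. free_basis R x y \<odot>\<^bsub>M\<^esub> \<phi> y)"
    using x by (intro linear_extension_superset R.free_basis_closed) (auto simp: free_basis_def)
  also have "\<dots> = \<phi> x"
    using x \<phi> by (auto simp: free_basis_def Pi_iff)
  finally show ?thesis .
qed

lemma linear_extension_hom: "abelian_group_hom (free_module R S) M (linear_extension R M \<phi>)"
  using linear_extension_closed linear_extension_add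
  by (intro abelian_group_homI F.M.abelian_group_axioms M.abelian_group_axioms group_hom.intro
      group_hom_axioms.intro F.M.a_group M.a_group) (auto simp: hom_def simp del: free_module_simps)

text \<open>Every tensor relator is a difference, so this turns its vanishing under the extension
  into an equation between two values.\<close>

lemma linear_extension_minus_eq_zero_iff:
  assumes g: "g \<in> carrier (free_module R S)" and h: "h \<in> carrier (free_module R S)"
  shows "linear_extension R M \<phi> (g \<ominus>\<^bsub>free_module R S\<^esub> h) = \<zero>\<^bsub>M\<^esub> \<longleftrightarrow>
    linear_extension R M \<phi> g = linear_extension R M \<phi> h"
proof -
  interpret H: abelian_group_hom "free_module R S" M "linear_extension R M \<phi>"
    by (rule linear_extension_hom)
  have "linear_extension R M \<phi> (g \<ominus>\<^bsub>free_module R S\<^esub> h) =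
      linear_extension R M \<phi> g \<ominus>\<^bsub>M\<^esub> linear_extension R M \<phi> h"
    using g h by (simp add: a_minus_def del: free_module_simps)
  \<comment> \<open>What remains is that a difference in \<open>M\<close> is zero exactly when its
    two terms agree, by uniqueness of additive inverses.\<close>
  then show ?thesis
    using linear_extension_closed[OF g] linear_extension_closed[OF h]
    by (metis M.a_inv_closed M.minus_equality M.minus_minus M.r_neg a_minus_def)
qed

text \<open>Since the kernel is a submodule, it contains the submodule generated by any set of
  elements that the extension kills.\<close>

lemma linear_extension_kernel:
  "submodule {g \<in> carrier (free_module R S). linear_extension R M \<phi> g = \<zero>\<^bsub>M\<^esub>} R (free_module R S)"
proof -
  interpret H: abelian_group_hom "free_module R S" M "linear_extension R M \<phi>"
    by (rule linear_extension_hom)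
  show ?thesis
    using H.hom_zero
    by (intro F.submoduleI) (auto simp: linear_extension_smult simp del: free_module_simps)
qed

end

end

text \<open>This is the part of the universal property that says \<open>f\<close> factors through
  the tensor product, tested only on pure tensors. It holds for any bilinear map, degenerate or
  not.\<close>

lemma (in bilinear_map) tensor_eq_zero_imp:
  assumes a: "a \<in> carrier A" and b: "b \<in> carrier B"
    and zero: "tensor R A B a b = \<zero>\<^bsub>tensor_product R A B\<^esub>"
  shows "f a b = \<zero>\<^bsub>C\<^esub>"
proof -
  let ?S = "carrier A \<times> carrier B"
  let ?F = "free_module R ?S"
  let ?f = "case_prod f"
  let ?L = "linear_extension R C ?f"
  interpret F: module R ?F
    by (rule A.R.free_module_is_module)
  have f: "?f \<in> ?S \<rightarrow> carrier C"
    using map_closed by auto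
  have basis: "free_basis R (x, y) \<in> carrier ?F" if "x \<in> carrier A" "y \<in> carrier B" for x y
    using that by (simp add: A.R.free_basis_closed)
  have L_basis: "?L (free_basis R (x, y)) = f x y" if "x \<in> carrier A" "y \<in> carrier B" for x y
    using that C.linear_extension_basis[OF f, of "(x, y)"] by simp
  note L = C.linear_extension_minus_eq_zero_iff[OF f] C.linear_extension_add[OF f]
    C.linear_extension_smult[OF f] L_basis basis
  \<comment> \<open>Each of the four kinds of relator is killed by the matching bilinearity law of
    \<open>f\<close>.\<close>
  have "?L g = \<zero>\<^bsub>C\<^esub>" if "g \<in> tensor_relators R A B" for g
    using that
    by cases (simp_all add: L add_left add_right smult_left smult_right del: free_module_simps)
  then have "tensor_kernel R A B \<subseteq> {g \<in> carrier ?F. ?L g = \<zero>\<^bsub>C\<^esub>}"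
    unfolding tensor_kernel_def
    using tensor_relators_subset[OF A.module_axioms B.module_axioms]
    by (intro F.generated_submodule_least C.linear_extension_kernel[OF f]) auto
  moreover have "free_basis R (a, b) \<in> tensor_kernel R A B"
  proof -
    interpret N: abelian_subgroup "tensor_kernel R A B" ?F
      by (intro F.submodule_abelian_subgroup tensor_kernel_submodule
          A.module_axioms B.module_axioms)
    show ?thesis
      \<comment> \<open>The zero of the quotient is \<open>tensor_kernel R A B\<close> itself, so
        \<open>zero\<close> identifies it with the coset of the basis element, and every element
        lies in its own coset.\<close>
      using N.a_rcos_self[OF basis[OF a b]] zero
      by (simp add: tensor_def tensor_product_def quotient_module_def)
  qed
  ultimately show ?thesis
    using L_basis[OF a b] by auto
qed

theorem lemma10:
  fixes R :: "('r, 'm) ring_scheme"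
    and A :: "('r, 'a, 'n) module_scheme"
    and B :: "('r, 'b, 'p) module_scheme"
    and C :: "('r, 'c, 'q) module_scheme"
    and f :: "'a \<Rightarrow> 'b \<Rightarrow> 'c"
  assumes "cring R"
    and "module R A" and "module R B"
    and "carrier A \<noteq> {\<zero>\<^bsub>A\<^esub>}" and "carrier B \<noteq> {\<zero>\<^bsub>B\<^esub>}"
    and "module R C" and "pairing R A B C f"
  shows "nondegenerate A B (tensor_product R A B) (tensor R A B)"
proof -
  interpret pairing R A B C f by fact
  show ?thesis
    using nondegenerate tensor_eq_zero_imp
    unfolding nondegenerate_def left_nondegenerate_def right_nondegenerate_def by blast
qed

end
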